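(* Let $\psi:[0,\lambda_{\max})\to[0,\infty)$ be a CGF-like function with $\sup_{\lambda\in[0,\lambda_{\max})}\psi'(\lambda)=\infty$. Let $(S_t)_{t\ge0}$ be a real-valued process that is sub-$\psi$ with variance proxy $(V_t)_{t\ge0}$, and suppose that $\psi''(0)=1$ and that $V_t\to\infty$ almost surely as $t\to\infty$. Then $$\limsup_{t\to\infty}\frac{S_t}{\sqrt{2V_t\log\log(V_t)}}\le 1\quad\text{almost surely}.$$
   Context: Time $t$ ranges over $\{0,1,2,\dots\}$. CGF-like: a twice continuously differentiable function $\psi:[0,\lambda_{\max})\to[0,\infty)$ is CGF-like if it is strictly convex, $\psi(0)=\psi'(0)=0$ and $\psi''(0)>0$. Sub-$\psi$ (scalar): let $(S_t)_{t\ge0}$ and $(V_t)_{t\ge0}$ be respectively $\mathbb{R}$-valued and $[0,\infty)$-valued processes adapted to some filtration $(\mathcal{F}_t)_{t\ge0}$. $(S_t)$ is sub-$\psi$ with variance proxy $(V_t)$ if for every $\lambda\in[0,\lambda_{\max})$ the process $\exp\{\lambda S_t-\psi(\lambda)V_t\}$ is (almost surely) upper bounded by some non-negative supermartingale $(L_t^\lambda)_{t\ge0}$ with respect to $(\mathcal{F}_t)_{t\ge0}$, that is, $\exp\{\lambda S_t-\psi(\lambda)V_t\}\le L_t^\lambda$ for all $t\ge0$.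
   Formalization: Sub-ψ is taken with the added normalization that the expectations of L_0^λ are bounded by one constant for all λ; without it the claim fails, e.g. for ψ(λ)=λ²/2, V_t=t, S_t=t^{3/4}, dominated by constants C(λ). *)

theory Defs
  imports "HOL-Probability.Probability"
begin

definition psi_dom :: "ereal \<Rightarrow> real set" where
  "psi_dom lmax = {l. 0 \<le> l \<and> ereal l < lmax}"

(* The derivative is taken relative to the domain, hence one-sided at 0. *)
definition psi_deriv :: "ereal \<Rightarrow> (real \<Rightarrow> real) \<Rightarrow> real \<Rightarrow> real" where
  "psi_deriv lmax \<psi> l = vector_derivative \<psi> (at l within psi_dom lmax)"

definition psi_deriv2 :: "ereal \<Rightarrow> (real \<Rightarrow> real) \<Rightarrow> real \<Rightarrow> real" where
  "psi_deriv2 lmax \<psi> = psi_deriv lmax (psi_deriv lmax \<psi>)"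

definition strictly_convex_on :: "real set \<Rightarrow> (real \<Rightarrow> real) \<Rightarrow> bool" where
  "strictly_convex_on A f \<longleftrightarrow> convex A \<and>
     (\<forall>x\<in>A. \<forall>y\<in>A. \<forall>u. x \<noteq> y \<longrightarrow> 0 < u \<longrightarrow> u < 1 \<longrightarrow>
        f ((1 - u) * x + u * y) < (1 - u) * f x + u * f y)"

(* lmax = \<infinity> is allowed. Values of \<psi> outside the domain are irrelevant. *)
definition cgf_like :: "ereal \<Rightarrow> (real \<Rightarrow> real) \<Rightarrow> bool" where
  "cgf_like lmax \<psi> \<longleftrightarrow>
     0 < lmax \<and>
     (\<forall>l\<in>psi_dom lmax. 0 \<le> \<psi> l) \<and>
     \<psi> differentiable_on psi_dom lmax \<and>
     psi_deriv lmax \<psi> differentiable_on psi_dom lmax \<and>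
     continuous_on (psi_dom lmax) (psi_deriv2 lmax \<psi>) \<and>
     strictly_convex_on (psi_dom lmax) \<psi> \<and>
     \<psi> 0 = 0 \<and> psi_deriv lmax \<psi> 0 = 0 \<and> 0 < psi_deriv2 lmax \<psi> 0"

definition filtration_of :: "'a measure \<Rightarrow> (nat \<Rightarrow> 'a measure) \<Rightarrow> bool" where
  "filtration_of M F \<longleftrightarrow> filtration (space M) F \<and> (\<forall>t. subalgebra M (F t))"

definition adapted :: "(nat \<Rightarrow> 'a measure) \<Rightarrow> (nat \<Rightarrow> 'a \<Rightarrow> real) \<Rightarrow> bool" where
  "adapted F X \<longleftrightarrow> (\<forall>t. X t \<in> borel_measurable (F t))"

definition supermartingale ::
  "'a measure \<Rightarrow> (nat \<Rightarrow> 'a measure) \<Rightarrow> (nat \<Rightarrow> 'a \<Rightarrow> real) \<Rightarrow> bool" where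
  "supermartingale M F L \<longleftrightarrow>
     adapted F L \<and> (\<forall>t. integrable M (L t)) \<and>
     (\<forall>s t. s \<le> t \<longrightarrow> (AE \<omega> in M. real_cond_exp M (F s) (L t) \<omega> \<le> L s \<omega>))"

(* The dominating supermartingales are normalised: their initial expectations have a bound
   l0 not depending on \<lambda> (l0 = 1 being the usual choice). Allowing them to start at arbitrary
   \<lambda>-dependent levels would make the notion too weak for any iterated-logarithm bound:
   with \<psi>(\<lambda>) = \<lambda>^2/2, the deterministic processes V_t = t and S_t = t^(3/4) satisfy
   exp(\<lambda> S_t - \<psi>(\<lambda>) V_t) \<le> C(\<lambda>) for all t, for each fixed \<lambda>, where C(\<lambda>) is a finite constant. *)
definition sub_psi ::
  "'a measure \<Rightarrow> (nat \<Rightarrow> 'a measure) \<Rightarrow> ereal \<Rightarrow> (real \<Rightarrow> real) \<Rightarrow>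
     (nat \<Rightarrow> 'a \<Rightarrow> real) \<Rightarrow> (nat \<Rightarrow> 'a \<Rightarrow> real) \<Rightarrow> bool" where
  "sub_psi M F lmax \<psi> S V \<longleftrightarrow>
     filtration_of M F \<and> adapted F S \<and> adapted F V \<and>
     (\<forall>t. \<forall>\<omega>\<in>space M. 0 \<le> V t \<omega>) \<and>
     (\<exists>l0. \<forall>l\<in>psi_dom lmax. \<exists>L.
        supermartingale M F L \<and>
        (\<forall>t. \<forall>\<omega>\<in>space M. 0 \<le> L t \<omega>) \<and>
        integral\<^sup>L M (L 0) \<le> l0 \<and>
        (AE \<omega> in M. \<forall>t. exp (l * S t \<omega> - \<psi> l * V t \<omega>) \<le> L t \<omega>))"

end

theory Submission
  imports Defs "HOL-Real_Asymp.Real_Asymp"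
begin

text \<open>
  The bound is obtained by peeling along geometric epochs. For a fixed \<open>l\<close>, Ville's maximal
  inequality for the supermartingale dominating \<open>exp (l S - \<psi>(l) V)\<close> says that, outside an event of
  probability at most \<open>l0 / c\<close>, the whole path stays below the line \<open>S < (ln c + \<psi>(l) V) / l\<close> (lemma
  \<open>sub_psi_crossing\<close>). No single line is good for all values of \<open>V\<close>, but each is nearly optimal for
  \<open>V\<close> in a bounded multiplicative range.

  Fix \<open>\<eta> > 1\<close> and use the line number \<open>k\<close>, with slope parameter \<open>l\<^sub>k = sqrt (2 ln k / \<eta>^k)\<close> and
  level \<open>c = k powr \<eta>\<close>, while \<open>\<eta>^k \<le> V \<le> \<eta>^(k+1)\<close>. The exceptional probabilities \<open>l0 k powr (-\<eta>)\<close>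
  are summable, so by Borel--Cantelli almost every path eventually respects all these lines. Since
  \<open>l\<^sub>k\<close> tends to 0 and \<open>\<psi>''(0) = 1\<close>, \<open>\<psi>(l\<^sub>k) \<le> \<eta> l\<^sub>k^2 / 2\<close> for large \<open>k\<close>; the parameter \<open>l\<^sub>k\<close> balances
  the two terms of the line at the left end of the epoch, and moving \<open>V\<close> through the epoch costs only
  a factor tending to 1 with \<open>\<eta>\<close>. On the epoch \<open>ln k\<close> is asymptotically \<open>ln (ln V)\<close>. Altogether
  \<open>S / sqrt (2 V ln (ln V)) \<le> \<eta>^3\<close> eventually (lemmas \<open>iterated_log_bound_from_lines\<close> and
  \<open>sub_psi_iterated_log_bound\<close>), and letting \<open>\<eta>\<close> decrease to 1 along a sequence gives the claim.

  Ville's inequality is proved by induction on the horizon: the level times the crossing probability,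
  plus the integral of the supermartingale over the paths that have not yet crossed, cannot increase
  with time (lemma \<open>Ville_finite_horizon\<close>).
\<close>

section \<open>Ville's maximal inequality\<close>

lemma supermartingale_set_integral_step:
  assumes "prob_space M" "filtration_of M F" "supermartingale M F L" "A \<in> sets (F n)"
  shows "(\<integral>x\<in>A. L (Suc n) x \<partial>M) \<le> (\<integral>x\<in>A. L n x \<partial>M)"
proof -
  interpret prob_space M by fact
  have sub: "subalgebra M (F n)" using assms(2) by (auto simp: filtration_of_def)
  interpret finite_measure_subalgebra M "F n" by standard (rule sub)
  have int: "integrable M (L t)" for t using assms(3) by (auto simp: supermartingale_def)
  have A: "A \<in> sets M" using sub assms(4) by (auto simp: subalgebra_def)
  have "(\<integral>x\<in>A. L (Suc n) x \<partial>M) = (\<integral>x\<in>A. real_cond_exp M (F n) (L (Suc n)) x \<partial>M)"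
    by (rule real_cond_exp_intA[OF int assms(4)])
  also have "\<dots> \<le> (\<integral>x\<in>A. L n x \<partial>M)"
    unfolding set_lebesgue_integral_def
  proof (rule integral_mono_AE)
    show "integrable M (\<lambda>x. indicator A x *\<^sub>R real_cond_exp M (F n) (L (Suc n)) x)"
      using integrable_mult_indicator[OF A real_cond_exp_int(1)[OF int]] .
    show "integrable M (\<lambda>x. indicator A x *\<^sub>R L n x)"
      using integrable_mult_indicator[OF A int] .
    have "AE x in M. real_cond_exp M (F n) (L (Suc n)) x \<le> L n x"
      using assms(3) by (auto simp: supermartingale_def)
    then show "AE x in M. indicator A x *\<^sub>R real_cond_exp M (F n) (L (Suc n)) x \<le> indicator A x *\<^sub>R L n x"
      by eventually_elim (auto simp: indicator_def)
  qed
  finally show ?thesis .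
qed

text \<open>
  The left-hand side is the expectation of the process stopped when it first reaches level \<open>c\<close>, with
  the overshoot cut down to \<open>c\<close>. The integral is part of the statement because it is what
  the induction on the horizon pays from: a path crossing at time \<open>n + 1\<close> is worth at least \<open>c\<close> there.
\<close>

lemma Ville_finite_horizon:
  assumes "prob_space M" "filtration_of M F" "supermartingale M F L"
  shows "c * measure M {x \<in> space M. \<exists>s\<le>n. c \<le> L s x}
       + (\<integral>x\<in>{x \<in> space M. \<forall>s\<le>n. L s x < c}. L n x \<partial>M) \<le> integral\<^sup>L M (L 0)"
proof -
  interpret prob_space M by fact
  define A where "A n = {x \<in> space M. \<exists>s\<le>n. c \<le> L s x}" for n
  define B where "B n = {x \<in> space M. \<forall>s\<le>n. L s x < c}" for n
  have int: "integrable M (L t)" for t using assms(3) by (auto simp: supermartingale_def)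
  have [measurable]: "L t \<in> borel_measurable M" for t using int by auto
  have [measurable]: "A n \<in> sets M" for n unfolding A_def by measurable
  have [measurable]: "B n \<in> sets M" for n unfolding B_def by measurable
  have meas_F: "L s \<in> borel_measurable (F n)" if "s \<le> n" for s n
  proof -
    have "L s \<in> borel_measurable (F s)" using assms(3) by (auto simp: supermartingale_def adapted_def)
    moreover have "subalgebra (F n) (F s)"
      using assms(2) that
      by (auto simp: filtration_of_def filtration_def subalgebra_def)
    ultimately show ?thesis by (rule measurable_from_subalg[rotated])
  qed
  have space_F: "space (F n) = space M" for n
    using assms(2) by (auto simp: filtration_of_def subalgebra_def)
  have B_F: "B n \<in> sets (F n)" for n
  proof -
    have "{x \<in> space (F n). L s x < c} \<in> sets (F n)" if "s \<in> {..n}" for s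
      using borel_measurable_less[OF meas_F borel_measurable_const] that by simp
    then have "(\<Inter>s\<in>{..n}. {x \<in> space (F n). L s x < c}) \<in> sets (F n)"
      by (intro sets.finite_INT) auto
    moreover have "B n = (\<Inter>s\<in>{..n}. {x \<in> space (F n). L s x < c})"
      by (auto simp: B_def space_F)
    ultimately show ?thesis by simp
  qed
  have int_L: "integrable M (\<lambda>x. indicator X x * L t x)" if "X \<in> sets M" for X t
    using integrable_mult_indicator[OF that int] by simp
  have int_c: "integrable M (\<lambda>x. c * indicator X x)" if "X \<in> sets M" for X
    using that by (intro integrable_mult_right integrable_real_indicator) (auto simp: emeasure_eq_measure)
  (* Under one integral sign the induction step becomes a pointwise comparison. *)
  have combine: "c * measure M X + (\<integral>x\<in>Y. L t x \<partial>M)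
      = (\<integral>x. c * indicator X x + indicator Y x * L t x \<partial>M)"
    if "X \<in> sets M" "Y \<in> sets M" for X Y t
  proof -
    have "X \<inter> space M = X" using sets.sets_into_space[OF that(1)] by auto
    then show ?thesis
      using Bochner_Integration.integral_add[OF int_c[OF that(1)] int_L[OF that(2), of t]]
      by (simp add: set_lebesgue_integral_def)
  qed
  have int_cL: "integrable M (\<lambda>x. c * indicator X x + indicator Y x * L t x)"
    if "X \<in> sets M" "Y \<in> sets M" for X Y t
    using int_c[OF that(1)] int_L[OF that(2)] by (rule Bochner_Integration.integrable_add)
  have "c * measure M (A n) + (\<integral>x\<in>B n. L n x \<partial>M) \<le> integral\<^sup>L M (L 0)"
  proof (induction n)
    case 0
    have "(\<integral>x. c * indicator (A 0) x + indicator (B 0) x * L 0 x \<partial>M) \<le> integral\<^sup>L M (L 0)"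
    proof (rule integral_mono[OF int_cL int])
      fix x assume "x \<in> space M"
      then show "c * indicator (A 0) x + indicator (B 0) x * L 0 x \<le> L 0 x"
        by (cases "c \<le> L 0 x") (auto simp: A_def B_def indicator_def)
    qed auto
    then show ?case by (simp add: combine)
  next
    case (Suc n)
    have "(\<integral>x. c * indicator (A (Suc n)) x + indicator (B (Suc n)) x * L (Suc n) x \<partial>M)
        \<le> (\<integral>x. c * indicator (A n) x + indicator (B n) x * L (Suc n) x \<partial>M)"
    proof (rule integral_mono[OF int_cL int_cL])
      fix x assume x: "x \<in> space M"
      have "x \<in> A (Suc n) \<longleftrightarrow> x \<in> A n \<or> c \<le> L (Suc n) x"
        using x by (auto simp: A_def le_Suc_eq)
      moreover have "x \<in> B m \<longleftrightarrow> x \<notin> A m" for m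
        using x by (simp add: A_def B_def) (meson not_le)
      ultimately show "c * indicator (A (Suc n)) x + indicator (B (Suc n)) x * L (Suc n) x
          \<le> c * indicator (A n) x + indicator (B n) x * L (Suc n) x"
        by (auto simp: indicator_def)
    qed auto
    then have "c * measure M (A (Suc n)) + (\<integral>x\<in>B (Suc n). L (Suc n) x \<partial>M)
        \<le> c * measure M (A n) + (\<integral>x\<in>B n. L (Suc n) x \<partial>M)"
      by (simp add: combine)
    (* Not having crossed by time n is decided at time n, so the supermartingale property applies. *)
    also have "(\<integral>x\<in>B n. L (Suc n) x \<partial>M) \<le> (\<integral>x\<in>B n. L n x \<partial>M)"
      by (rule supermartingale_set_integral_step[OF assms(1-3) B_F])
    finally show ?case using Suc by simp
  qed
  then show ?thesis by (simp add: A_def B_def)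
qed

lemma Ville_inequality:
  assumes "prob_space M" "filtration_of M F" "supermartingale M F L"
    and nonneg: "\<And>t x. x \<in> space M \<Longrightarrow> 0 \<le> L t x" and "0 < c"
  shows "measure M {x \<in> space M. \<exists>t. c \<le> L t x} \<le> integral\<^sup>L M (L 0) / c"
proof -
  interpret prob_space M by fact
  define A where "A n = {x \<in> space M. \<exists>s\<le>n. c \<le> L s x}" for n
  have [measurable]: "L t \<in> borel_measurable M" for t
    using assms(3) by (auto simp: supermartingale_def)
  have "A n \<in> sets M" for n unfolding A_def by measurable
  moreover have "incseq A" by (auto simp: A_def incseq_def) (meson le_trans)
  ultimately have "(\<lambda>n. measure M (A n)) \<longlonglongrightarrow> measure M (\<Union>n. A n)"
    by (intro finite_Lim_measure_incseq) auto
  moreover have "measure M (A n) \<le> integral\<^sup>L M (L 0) / c" for n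
  proof -
    have "0 \<le> (\<integral>x\<in>{x \<in> space M. \<forall>s\<le>n. L s x < c}. L n x \<partial>M)"
      unfolding set_lebesgue_integral_def
      by (rule Bochner_Integration.integral_nonneg) (auto simp: indicator_def nonneg)
    then have "c * measure M (A n) \<le> integral\<^sup>L M (L 0)"
      using Ville_finite_horizon[OF assms(1-3), of c n] by (simp add: A_def)
    then show ?thesis using \<open>0 < c\<close> by (simp add: field_simps)
  qed
  ultimately have "measure M (\<Union>n. A n) \<le> integral\<^sup>L M (L 0) / c"
    by (blast intro: LIMSEQ_le_const2)
  also have "(\<Union>n. A n) = {x \<in> space M. \<exists>t. c \<le> L t x}" by (auto simp: A_def)
  finally show ?thesis .
qed

section \<open>Line crossing and the behaviour of \<open>\<psi>\<close> near 0\<close>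

text \<open>
  The constant \<open>l0\<close> does not depend on the slope parameter \<open>l\<close>; this uniformity is what makes the
  probabilities summable when \<open>l\<close> varies from epoch to epoch.
\<close>

lemma sub_psi_crossing:
  assumes "prob_space M" "sub_psi M F lmax \<psi> S V"
  obtains l0 where
    "\<And>l c. l \<in> psi_dom lmax \<Longrightarrow> 0 < c \<Longrightarrow>
       measure M {x \<in> space M. \<exists>t. c \<le> exp (l * S t x - \<psi> l * V t x)} \<le> l0 / c"
proof -
  interpret prob_space M by fact
  from assms(2) obtain l0 where filt: "filtration_of M F" and L: "\<And>l. l\<in>psi_dom lmax \<Longrightarrow> \<exists>L.
        supermartingale M F L \<and>
        (\<forall>t. \<forall>\<omega>\<in>space M. 0 \<le> L t \<omega>) \<and>
        integral\<^sup>L M (L 0) \<le> l0 \<and>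
        (AE \<omega> in M. \<forall>t. exp (l * S t \<omega> - \<psi> l * V t \<omega>) \<le> L t \<omega>)"
    unfolding sub_psi_def by blast
  have "measure M {x \<in> space M. \<exists>t. c \<le> exp (l * S t x - \<psi> l * V t x)} \<le> l0 / c"
    if l: "l \<in> psi_dom lmax" and c: "0 < c" for l c
  proof -
    obtain L where sup: "supermartingale M F L" and nn: "\<And>t x. x \<in> space M \<Longrightarrow> 0 \<le> L t x"
      and L0: "integral\<^sup>L M (L 0) \<le> l0"
      and dom: "AE \<omega> in M. \<forall>t. exp (l * S t \<omega> - \<psi> l * V t \<omega>) \<le> L t \<omega>"
      using L[OF l] by blast
    have [measurable]: "L t \<in> borel_measurable M" for t
      using sup by (auto simp: supermartingale_def)
    have "measure M {x \<in> space M. \<exists>t. c \<le> exp (l * S t x - \<psi> l * V t x)}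
        \<le> measure M {x \<in> space M. \<exists>t. c \<le> L t x}"
    proof (rule finite_measure_mono_AE)
      show "AE x in M. x \<in> {x \<in> space M. \<exists>t. c \<le> exp (l * S t x - \<psi> l * V t x)} \<longrightarrow>
          x \<in> {x \<in> space M. \<exists>t. c \<le> L t x}"
        using dom by eventually_elim (auto intro: order_trans)
    qed measurable
    also have "\<dots> \<le> integral\<^sup>L M (L 0) / c"
      by (rule Ville_inequality[OF assms(1) filt sup nn c])
    also have "\<dots> \<le> l0 / c" using L0 c by (simp add: divide_right_mono)
    finally show ?thesis .
  qed
  then show ?thesis using that by blast
qed

text \<open>
  The derivative \<open>\<psi>'\<close> vanishes at 0 and has slope 1 there, so \<open>\<psi>'(x) \<le> \<eta> x\<close> for small \<open>x\<close>, and the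
  mean value theorem applied to \<open>\<eta> x^2 / 2 - \<psi>(x)\<close> passes this on to \<open>\<psi>\<close>.
\<close>

lemma cgf_like_quadratic_bound:
  assumes "cgf_like lmax \<psi>" "psi_deriv2 lmax \<psi> 0 = 1" "1 < \<eta>"
  shows "\<forall>\<^sub>F l in at_right 0. l \<in> psi_dom lmax \<and> \<psi> l \<le> \<eta> * (l\<^sup>2 / 2)"
proof -
  let ?D = "psi_dom lmax"
  define \<psi>' where "\<psi>' = psi_deriv lmax \<psi>"
  have lmax: "0 < lmax" and "\<psi> differentiable_on ?D" "\<psi>' differentiable_on ?D"
    and [simp]: "\<psi> 0 = 0" "\<psi>' 0 = 0"
    using assms(1) by (auto simp: cgf_like_def \<psi>'_def)
  have D0: "0 \<in> ?D" using lmax by (auto simp: psi_dom_def zero_ereal_def[symmetric])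
  have Dle: "y \<in> ?D" if "x \<in> ?D" "0 \<le> y" "y \<le> x" for x y
  proof -
    have "ereal y \<le> ereal x" "ereal x < lmax" using that by (auto simp: psi_dom_def)
    then have "ereal y < lmax" by (rule le_less_trans)
    then show ?thesis using that by (simp add: psi_dom_def)
  qed
  obtain b where b: "0 < b" "b \<in> ?D"
  proof -
    obtain z where "0 < z" "z < lmax" using lmax dense by blast
    then show ?thesis by (intro that[of "real_of_ereal z"]; cases z) (auto simp: psi_dom_def)
  qed
  have d1: "(\<psi> has_vector_derivative \<psi>' x) (at x within ?D)" if "x \<in> ?D" for x
    using \<open>\<psi> differentiable_on ?D\<close> that
    by (auto simp: differentiable_on_def vector_derivative_works \<psi>'_def psi_deriv_def)
  have "(\<psi>' has_vector_derivative 1) (at 0 within ?D)"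
    using \<open>\<psi>' differentiable_on ?D\<close> D0 assms(2)
    by (auto simp: differentiable_on_def vector_derivative_works psi_deriv2_def \<psi>'_def psi_deriv_def[of _ "psi_deriv _ _"])
  then have "((\<lambda>y. \<psi>' y / y) \<longlongrightarrow> 1) (at 0 within ?D)"
    by (simp add: has_real_derivative_iff_has_vector_derivative[symmetric] has_field_derivative_iff)
  then have "\<forall>\<^sub>F y in at 0 within ?D. \<psi>' y / y < \<eta>"
    using assms(3) by (rule order_tendstoD)
  then obtain d where d: "0 < d" "\<And>y. y \<in> ?D \<Longrightarrow> y \<noteq> 0 \<Longrightarrow> \<bar>y\<bar> < d \<Longrightarrow> \<psi>' y / y < \<eta>"
    by (auto simp: eventually_at dist_real_def)
  have "l \<in> ?D \<and> \<psi> l \<le> \<eta> * (l\<^sup>2 / 2)" if l: "0 < l" "l < min b d" for l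
  proof
    show lD: "l \<in> ?D" using Dle[OF b(2)] l by auto
    have "\<eta> * (0\<^sup>2 / 2) - \<psi> 0 \<le> \<eta> * (l\<^sup>2 / 2) - \<psi> l"
    proof -
      have "\<exists>x\<in>{0<..<l}. (\<eta> * (l\<^sup>2 / 2) - \<psi> l) - (\<eta> * (0\<^sup>2 / 2) - \<psi> 0) = (\<eta> * x - \<psi>' x) * (l - 0)"
      proof (rule mvt_simple[OF l(1)])
        fix x assume x: "0 \<le> x" "x \<le> l"
        have "{0..l} \<subseteq> ?D" using Dle[OF lD] by auto
        then have "(\<psi> has_real_derivative \<psi>' x) (at x within {0..l})"
          unfolding has_real_derivative_iff_has_vector_derivative
          by (rule has_vector_derivative_within_subset[OF d1[OF Dle[OF lD x]]])
        then have "((\<lambda>x. \<eta> * (x\<^sup>2 / 2) - \<psi> x) has_real_derivative \<eta> * x - \<psi>' x) (at x within {0..l})"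
          by (auto intro!: derivative_eq_intros)
        then show "((\<lambda>x. \<eta> * (x\<^sup>2 / 2) - \<psi> x) has_derivative (\<lambda>h. (\<eta> * x - \<psi>' x) * h)) (at x within {0..l})"
          by (simp add: has_field_derivative_def)
      qed
      then obtain x where x: "0 < x" "x < l"
        and eq: "(\<eta> * (l\<^sup>2 / 2) - \<psi> l) - (\<eta> * (0\<^sup>2 / 2) - \<psi> 0) = (\<eta> * x - \<psi>' x) * (l - 0)"
        by auto
      have "\<psi>' x / x < \<eta>" using d(2)[of x] Dle[OF lD, of x] x l by auto
      then have "0 \<le> (\<eta> * x - \<psi>' x) * (l - 0)" using x l by (simp add: field_simps)
      then show ?thesis using eq by linarith
    qed
    then show "\<psi> l \<le> \<eta> * (l\<^sup>2 / 2)" by simp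
  qed
  then show ?thesis
    using b d by (intro eventually_at_rightI[of 0 "min b d"]) auto
qed


section \<open>From lines to the iterated logarithm\<close>

text \<open>
  With \<open>w = v / b\<close> in \<open>[1, \<eta>]\<close>, the line divided by the factor \<open>\<eta>\<close> is \<open>L (1 + w)\<close>, whereas the product
  of the slope parameter and \<open>sqrt (2 v L)\<close> is \<open>2 L sqrt w\<close>. They agree at \<open>w = 1\<close>, and
  \<open>1 + w \<le> 2 \<eta> \<le> 2 \<eta> sqrt w\<close> bounds the loss on the rest of the epoch.
\<close>

lemma line_bound_on_epoch:
  fixes \<eta> :: real
  assumes "1 \<le> \<eta>" "0 < L" "0 < b" "b \<le> v" "v \<le> \<eta> * b"
    and line: "sqrt (2 * L / b) * s \<le> \<eta> * L + \<eta> * ((sqrt (2 * L / b))\<^sup>2 / 2) * v"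
  shows "s \<le> \<eta>\<^sup>2 * sqrt (2 * v * L)"
proof -
  define w where "w = v / b"
  have w: "1 \<le> w" "w \<le> \<eta>" using assms by (auto simp: w_def field_simps)
  have "1 + w \<le> 2 * \<eta>" using w by simp
  also have "\<dots> \<le> 2 * \<eta> * sqrt w" using w assms(1) by (simp add: mult_le_cancel_left1)
  finally have "\<eta> * L * (1 + w) \<le> \<eta> * L * (2 * \<eta> * sqrt w)"
    using assms by (intro mult_left_mono) auto
  moreover have "\<eta> * L + \<eta> * ((sqrt (2 * L / b))\<^sup>2 / 2) * v = \<eta> * L * (1 + w)"
    using assms by (simp add: w_def algebra_simps)
  moreover have "\<eta> * L * (2 * \<eta> * sqrt w) = sqrt (2 * L / b) * (\<eta>\<^sup>2 * sqrt (2 * v * L))"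
  proof -
    have "sqrt (2 * L / b) * sqrt (2 * v * L) = sqrt ((2 * L)\<^sup>2 * w)"
      unfolding real_sqrt_mult[symmetric] by (simp add: w_def power2_eq_square mult_ac)
    also have "\<dots> = 2 * L * sqrt w" using assms by (simp add: real_sqrt_mult)
    finally show ?thesis by (simp add: power2_eq_square)
  qed
  ultimately have "sqrt (2 * L / b) * s \<le> sqrt (2 * L / b) * (\<eta>\<^sup>2 * sqrt (2 * v * L))"
    using line by linarith
  then show ?thesis using assms by (simp add: mult_le_cancel_left_pos)
qed

lemma obtain_epoch:
  fixes \<eta> v :: real
  assumes "1 < \<eta>" "\<eta> ^ N \<le> v"
  obtains k where "N \<le> k" "\<eta> ^ k \<le> v" "v \<le> \<eta> * \<eta> ^ k"
proof -
  define m where "m = (LEAST m. v < \<eta> ^ m)"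
  obtain m' where "v < \<eta> ^ m'" using real_arch_pow[OF assms(1)] by blast
  then have m: "v < \<eta> ^ m" and least: "\<And>j. j < m \<Longrightarrow> \<eta> ^ j \<le> v"
    unfolding m_def by (auto intro: LeastI dest!: not_less_Least)
  have "N < m"
    using le_less_trans[OF assms(2) m] assms(1) by (simp add: power_strict_increasing_iff)
  then obtain k where "m = Suc k" by (cases m) auto
  then show ?thesis using that[of k] \<open>N < m\<close> m least[of k] by auto
qed

text \<open>
  This is the purely deterministic part, for a single path. Of the three factors \<open>\<eta>\<close>, two come from
  the position of \<open>v t\<close> within its epoch and the bound on \<open>\<psi>\<close>, the third from replacing \<open>ln k\<close> by
  \<open>ln (ln (v t))\<close>: on epoch \<open>k\<close> one has \<open>ln (ln (v t)) \<ge> ln k + ln (ln \<eta>)\<close>, where the constant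
  \<open>ln (ln \<eta>)\<close> may be negative but is negligible against \<open>ln k\<close>.
\<close>

lemma iterated_log_bound_from_lines:
  fixes s v :: "nat \<Rightarrow> real" and \<psi> :: "real \<Rightarrow> real"
  assumes \<eta>: "1 < \<eta>"
    and lines: "\<forall>\<^sub>F k in sequentially. \<forall>t.
       sqrt (2 * ln k / \<eta> ^ k) * s t - \<psi> (sqrt (2 * ln k / \<eta> ^ k)) * v t < \<eta> * ln k"
    and quad: "\<forall>\<^sub>F k in sequentially.
       \<psi> (sqrt (2 * ln k / \<eta> ^ k)) \<le> \<eta> * ((sqrt (2 * ln k / \<eta> ^ k))\<^sup>2 / 2)"
    and v: "filterlim v at_top sequentially"
  shows "\<forall>\<^sub>F t in sequentially. s t / sqrt (2 * v t * ln (ln (v t))) \<le> \<eta> ^ 3"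
proof -
  have "\<forall>\<^sub>F k in sequentially. ln (real k) \<le> \<eta>\<^sup>2 * (ln (real k) + ln (ln \<eta>))"
    using \<eta> by real_asymp
  then have "\<forall>\<^sub>F k in sequentially.
      (\<forall>t. sqrt (2 * ln k / \<eta> ^ k) * s t - \<psi> (sqrt (2 * ln k / \<eta> ^ k)) * v t < \<eta> * ln k)
      \<and> \<psi> (sqrt (2 * ln k / \<eta> ^ k)) \<le> \<eta> * ((sqrt (2 * ln k / \<eta> ^ k))\<^sup>2 / 2)
      \<and> ln (real k) \<le> \<eta>\<^sup>2 * (ln (real k) + ln (ln \<eta>)) \<and> 2 \<le> k"
    using lines quad eventually_ge_at_top[of "2::nat"] by eventually_elim simp
  then obtain N where N: "\<And>k. N \<le> k \<Longrightarrow>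
      (\<forall>t. sqrt (2 * ln k / \<eta> ^ k) * s t - \<psi> (sqrt (2 * ln k / \<eta> ^ k)) * v t < \<eta> * ln k)
      \<and> \<psi> (sqrt (2 * ln k / \<eta> ^ k)) \<le> \<eta> * ((sqrt (2 * ln k / \<eta> ^ k))\<^sup>2 / 2)
      \<and> ln (real k) \<le> \<eta>\<^sup>2 * (ln (real k) + ln (ln \<eta>)) \<and> 2 \<le> k"
    by (auto simp: eventually_at_top_linorder)
  (* The lower bound exp 2 makes ln (ln (v t)) positive. *)
  have "\<forall>\<^sub>F t in sequentially. max (\<eta> ^ N) (exp 2) \<le> v t"
    using v unfolding filterlim_at_top by blast
  then show ?thesis
  proof eventually_elim
    case (elim t)
    define V where "V = v t"
    have V: "\<eta> ^ N \<le> V" "exp 2 \<le> V" using elim by (auto simp: V_def)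
    have V0: "0 < V" using V(2) by (rule less_le_trans[rotated]) simp
    have "2 \<le> ln V" using V(2) V0 by (simp add: ln_ge_iff)
    then have lnln: "0 < ln (ln V)" by simp
    obtain k where k: "N \<le> k" "\<eta> ^ k \<le> V" "V \<le> \<eta> * \<eta> ^ k"
      using obtain_epoch[OF \<eta> V(1)] .
    define l where "l = sqrt (2 * ln k / \<eta> ^ k)"
    from N[OF k(1)] have line: "l * s t - \<psi> l * V < \<eta> * ln k" and q: "\<psi> l \<le> \<eta> * (l\<^sup>2 / 2)"
      and lnk: "ln (real k) \<le> \<eta>\<^sup>2 * (ln (real k) + ln (ln \<eta>))" and k2: "2 \<le> k"
      by (auto simp: l_def V_def)
    have "\<psi> l * V \<le> \<eta> * (l\<^sup>2 / 2) * V" using q V0 by (simp add: mult_right_mono)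
    with line have "l * s t \<le> \<eta> * ln k + \<eta> * (l\<^sup>2 / 2) * V" by linarith
    then have "s t \<le> \<eta>\<^sup>2 * sqrt (2 * V * ln k)"
      unfolding l_def using \<eta> k k2 by (intro line_bound_on_epoch[of \<eta> _ "\<eta> ^ k"]) auto
    also have "\<dots> \<le> \<eta>\<^sup>2 * sqrt (\<eta>\<^sup>2 * (2 * V * ln (ln V)))"
    proof -
      have "ln (\<eta> ^ k) \<le> ln V" using k \<eta> V0 by (subst ln_le_cancel_iff) auto
      then have "real k * ln \<eta> \<le> ln V" using \<eta> by (simp add: ln_realpow)
      then have "ln (real k * ln \<eta>) \<le> ln (ln V)"
        using \<eta> k2 \<open>2 \<le> ln V\<close> by (subst ln_le_cancel_iff) auto
      then have "ln (real k) + ln (ln \<eta>) \<le> ln (ln V)" using \<eta> k2 by (simp add: ln_mult)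
      then have "\<eta>\<^sup>2 * (ln (real k) + ln (ln \<eta>)) \<le> \<eta>\<^sup>2 * ln (ln V)"
        by (intro mult_left_mono) auto
      with lnk have "ln (real k) \<le> \<eta>\<^sup>2 * ln (ln V)" by linarith
      then have "2 * V * ln (real k) \<le> 2 * V * (\<eta>\<^sup>2 * ln (ln V))"
        using V0 by (intro mult_left_mono) auto
      then show ?thesis by (intro mult_left_mono real_sqrt_le_mono) (auto simp: mult_ac)
    qed
    also have "\<dots> = \<eta> ^ 3 * sqrt (2 * V * ln (ln V))"
      using \<eta> by (simp add: real_sqrt_mult power2_eq_square power3_eq_cube)
    finally show ?case using V0 lnln by (simp add: V_def pos_divide_le_eq)
  qed
qed

section \<open>The almost sure bound\<close>

text \<open>
  The level \<open>k powr \<eta>\<close> is chosen as the smallest power of \<open>k\<close>, up to the choice of \<open>\<eta> > 1\<close>, for which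
  the crossing probabilities are summable; its logarithm \<open>\<eta> ln k\<close> is then within a factor \<open>\<eta>\<close> of the
  \<open>ln k\<close> that yields the constant 1 in the limit.
\<close>

lemma sub_psi_iterated_log_bound:
  assumes "prob_space M" "cgf_like lmax \<psi>" "sub_psi M F lmax \<psi> S V"
    and "psi_deriv2 lmax \<psi> 0 = 1"
    and div: "AE \<omega> in M. filterlim (\<lambda>t. V t \<omega>) at_top sequentially"
    and \<eta>: "1 < \<eta>"
  shows "AE \<omega> in M. \<forall>\<^sub>F t in sequentially. S t \<omega> / sqrt (2 * V t \<omega> * ln (ln (V t \<omega>))) \<le> \<eta> ^ 3"
proof -
  interpret prob_space M by fact
  have [measurable]: "S t \<in> borel_measurable M" "V t \<in> borel_measurable M" for t
    using assms(3)
    by (auto simp: sub_psi_def filtration_of_def adapted_def intro: measurable_from_subalg)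
  obtain l0 where l0: "\<And>l c. l \<in> psi_dom lmax \<Longrightarrow> 0 < c \<Longrightarrow>
       measure M {x \<in> space M. \<exists>t. c \<le> exp (l * S t x - \<psi> l * V t x)} \<le> l0 / c"
    using sub_psi_crossing[OF assms(1,3)] by blast
  define l where "l k = sqrt (2 * ln (real k) / \<eta> ^ k)" for k
  have "filterlim l (at_right 0) sequentially"
    unfolding l_def using \<eta> by real_asymp
  from eventually_compose_filterlim[OF cgf_like_quadratic_bound[OF assms(2,4) \<eta>] this]
  have quad: "\<forall>\<^sub>F k in sequentially. l k \<in> psi_dom lmax \<and> \<psi> (l k) \<le> \<eta> * ((l k)\<^sup>2 / 2)" .
  define B where "B k = {x \<in> space M. \<exists>t. real k powr \<eta> \<le> exp (l k * S t x - \<psi> (l k) * V t x)}" for k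
  have "AE x in M. \<forall>\<^sub>F k in sequentially. x \<in> space M - B k"
  proof (rule borel_cantelli_AE1)
    show "B k \<in> sets M" for k unfolding B_def by measurable
    show "summable (\<lambda>k. measure M (B k))"
    proof (rule summable_comparison_test_ev)
      show "summable (\<lambda>k. l0 * real k powr - \<eta>)"
        using \<eta> by (intro summable_mult) (simp add: summable_real_powr_iff)
      show "\<forall>\<^sub>F k in sequentially. norm (measure M (B k)) \<le> l0 * real k powr - \<eta>"
        using quad eventually_gt_at_top[of "0::nat"]
        by eventually_elim (use l0 in \<open>auto simp: B_def powr_minus_divide\<close>)
    qed
  qed (simp add: emeasure_eq_measure)
  with div show ?thesis
  proof eventually_elim
    case (elim x)
    show ?case
    proof (rule iterated_log_bound_from_lines[OF \<eta>, of "\<lambda>t. S t x" \<psi>])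
      from elim(2) eventually_gt_at_top[of "0::nat"]
      show "\<forall>\<^sub>F k in sequentially. \<forall>t. sqrt (2 * ln k / \<eta> ^ k) * S t x
          - \<psi> (sqrt (2 * ln k / \<eta> ^ k)) * V t x < \<eta> * ln k"
        unfolding l_def[symmetric]
      proof eventually_elim
        case (elim k)
        then have "exp (l k * S t x - \<psi> (l k) * V t x) < exp (\<eta> * ln k)" for t
          by (auto simp: B_def not_le powr_def)
        then show ?case by simp
      qed
    qed (use quad elim in \<open>auto simp: l_def elim: eventually_mono\<close>)
  qed
qed

theorem corollary3p3:
  fixes M :: "'a measure"
    and F :: "nat \<Rightarrow> 'a measure"
    and lmax :: ereal
    and \<psi> :: "real \<Rightarrow> real"
    and S V :: "nat \<Rightarrow> 'a \<Rightarrow> real"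
  assumes "prob_space M"
    and "cgf_like lmax \<psi>"
    and "(SUP l\<in>psi_dom lmax. ereal (psi_deriv lmax \<psi> l)) = \<infinity>"
    and "sub_psi M F lmax \<psi> S V"
    and "psi_deriv2 lmax \<psi> 0 = 1"
    and "AE \<omega> in M. filterlim (\<lambda>t. V t \<omega>) at_top sequentially"
  shows "AE \<omega> in M.
    limsup (\<lambda>t. ereal (S t \<omega> / sqrt (2 * V t \<omega> * ln (ln (V t \<omega>))))) \<le> 1"
proof -
  define \<eta> :: "nat \<Rightarrow> real" where "\<eta> n = 1 + 1 / real (Suc n)" for n
  have "AE \<omega> in M. \<forall>n. \<forall>\<^sub>F t in sequentially.
      S t \<omega> / sqrt (2 * V t \<omega> * ln (ln (V t \<omega>))) \<le> \<eta> n ^ 3"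
  proof (rule AE_all_countable[THEN iffD2], rule allI)
    fix n
    have "1 < \<eta> n" by (simp add: \<eta>_def)
    then show "AE \<omega> in M. \<forall>\<^sub>F t in sequentially.
        S t \<omega> / sqrt (2 * V t \<omega> * ln (ln (V t \<omega>))) \<le> \<eta> n ^ 3"
      by (rule sub_psi_iterated_log_bound[OF assms(1,2,4,5,6)])
  qed
  then show ?thesis
  proof eventually_elim
    case (elim \<omega>)
    have "limsup (\<lambda>t. ereal (S t \<omega> / sqrt (2 * V t \<omega> * ln (ln (V t \<omega>))))) \<le> ereal (\<eta> n ^ 3)" for n
    proof (rule Limsup_bounded)
      show "\<forall>\<^sub>F t in sequentially.
          ereal (S t \<omega> / sqrt (2 * V t \<omega> * ln (ln (V t \<omega>)))) \<le> ereal (\<eta> n ^ 3)"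
        using elim by (simp only: ereal_less_eq)
    qed
    moreover have "(\<lambda>n. ereal (\<eta> n ^ 3)) \<longlonglongrightarrow> ereal 1"
    proof -
      have "\<eta> \<longlonglongrightarrow> 1 + 0"
        unfolding \<eta>_def by (intro tendsto_add tendsto_const LIMSEQ_Suc[OF lim_1_over_n])
      from tendsto_power[OF this, of 3] show ?thesis by (intro tendsto_ereal) simp
    qed
    ultimately show ?case
      unfolding one_ereal_def by (rule LIMSEQ_le_const[rotated, OF exI, OF allI, OF impI])
  qed
qed

end
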